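(* Let $G$ and $H$ be finite simple undirected graphs with $k=\chi(G^2)$ and $n=|V(H)|$. Then $$\chi_o^+(G[H])\le k\,(n+2^n)^{k-1}\,\chi_o^+(H).$$
   Context: An oriented graph is a digraph with no loops, no multiple arcs and no pair of opposite arcs; an orientation of an undirected graph gives each edge one of its two directions. A homomorphism between oriented graphs is a vertex map sending arcs to arcs. The upper oriented chromatic number $\chi_o^+(G)$ is the smallest order of an oriented graph $\vec T$ such that every orientation of $G$ admits a homomorphism to $\vec T$. The square $G^2$ has vertex set $V(G)$, with $u,v$ adjacent iff their distance in $G$ is 1 or 2; $\chi$ is the chromatic number. The lexicographic product $G[H]$ has vertex set $V(G)\times V(H)$, and $\{[u,v],[u',v']\}$ is an edge iff either $\{u,u'\}\in E(G)$, or $u=u'$ and $\{v,v'\}\in E(H)$. *)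

theory Defs
  imports "Graph_Theory.Graph_Theory" "HOL-Library.FuncSet"
begin

text \<open>
  Finite simple undirected graphs are the finite, loop-free, symmetric digraphs of the locale
  \<^locale>\<open>pair_graph\<close>: an edge \<open>{u, v}\<close> is the pair of arcs \<open>(u, v)\<close> and \<open>(v, u)\<close>.
\<close>

locale oriented_graph = pair_digraph +
  assumes no_opposite_arcs: "(u, v) \<in> parcs G \<Longrightarrow> (v, u) \<notin> parcs G"

definition orientation_of :: "'a pair_pre_digraph \<Rightarrow> 'a pair_pre_digraph \<Rightarrow> bool" where
  "orientation_of D G \<longleftrightarrow>
     pverts D = pverts G \<and> parcs D \<subseteq> parcs G \<and>
     (\<forall>u v. (u, v) \<in> parcs G \<longrightarrow> ((u, v) \<in> parcs D) \<noteq> ((v, u) \<in> parcs D))"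

definition digraph_hom :: "('a \<Rightarrow> 'b) \<Rightarrow> 'a pair_pre_digraph \<Rightarrow> 'b pair_pre_digraph \<Rightarrow> bool" where
  "digraph_hom f D T \<longleftrightarrow>
     f \<in> pverts D \<rightarrow> pverts T \<and> (\<forall>u v. (u, v) \<in> parcs D \<longrightarrow> (f u, f v) \<in> parcs T)"

definition orientations_target :: "'a pair_pre_digraph \<Rightarrow> 'b pair_pre_digraph \<Rightarrow> bool" where
  "orientations_target G T \<longleftrightarrow>
     oriented_graph T \<and> (\<forall>D. orientation_of D G \<longrightarrow> (\<exists>f. digraph_hom f D T))"

text \<open>
  Targets range over the (finite) oriented graphs on natural numbers, which up to isomorphism
  are all finite oriented graphs; see \<open>upper_oriented_chromatic_number_le\<close> below.
\<close>

definition upper_oriented_chromatic_number :: "'a pair_pre_digraph \<Rightarrow> nat" where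
  "upper_oriented_chromatic_number G =
     (LEAST m. \<exists>T :: nat pair_pre_digraph. orientations_target G T \<and> card (pverts T) = m)"

definition proper_colouring :: "'a pair_pre_digraph \<Rightarrow> nat \<Rightarrow> ('a \<Rightarrow> nat) \<Rightarrow> bool" where
  "proper_colouring G k c \<longleftrightarrow>
     c \<in> pverts G \<rightarrow> {..<k} \<and> (\<forall>u v. (u, v) \<in> parcs G \<longrightarrow> c u \<noteq> c v)"

definition chromatic_number :: "'a pair_pre_digraph \<Rightarrow> nat" where
  "chromatic_number G = (LEAST k. \<exists>c. proper_colouring G k c)"

text \<open>With unit arc weights, the shortest-path cost is the usual distance (infinite if unreachable).\<close>

definition graph_distance :: "'a pair_pre_digraph \<Rightarrow> 'a \<Rightarrow> 'a \<Rightarrow> ereal" where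
  "graph_distance G u v = wf_digraph.\<mu> (with_proj G) (\<lambda>_. 1) u v"

definition graph_square :: "'a pair_pre_digraph \<Rightarrow> 'a pair_pre_digraph" where
  "graph_square G =
     \<lparr> pverts = pverts G,
       parcs = {(u, v). u \<in> pverts G \<and> v \<in> pverts G \<and>
                        (graph_distance G u v = 1 \<or> graph_distance G u v = 2)} \<rparr>"

definition lex_product ::
    "'a pair_pre_digraph \<Rightarrow> 'b pair_pre_digraph \<Rightarrow> ('a \<times> 'b) pair_pre_digraph" where
  "lex_product G H =
     \<lparr> pverts = pverts G \<times> pverts H,
       parcs = {((u, v), (u', v')).
                  (u, v) \<in> pverts G \<times> pverts H \<and> (u', v') \<in> pverts G \<times> pverts H \<and>
                  ((u, u') \<in> parcs G \<or> u = u' \<and> (v, v') \<in> parcs H)} \<rparr>"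

lemma pair_graph_lex_product:
  assumes "pair_graph G" "pair_graph H"
  shows "pair_graph (lex_product G H)"
proof -
  interpret G: pair_graph G by fact
  interpret H: pair_graph H by fact
  have fin: "finite ((pverts G \<times> pverts H) \<times> (pverts G \<times> pverts H))"
    by simp
  show ?thesis
  proof unfold_locales
    show "finite (parcs (lex_product G H))"
      by (rule finite_subset[OF _ fin]) (auto simp: lex_product_def)
    show "symmetric (with_proj (lex_product G H))"
      by (auto simp: symmetric_def lex_product_def sym_def
          intro: G.arcs_symmetric H.arcs_symmetric)
  qed (auto simp: lex_product_def dest: G.no_loops' H.no_loops')
qed

lemma (in pair_graph) graph_distance_eq:
  "graph_distance G u v = (INF p\<in>{p. awalk u p v}. ereal (real (length p)))"
proof -
  have "awalk_cost (\<lambda>_. 1) p = real (length p)" for p :: "('a \<times> 'a) list"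
    by (induction p) auto
  then show ?thesis
    unfolding graph_distance_def \<mu>_def by simp
qed

lemma (in pair_graph) graph_distance_commute: "graph_distance G u v = graph_distance G v u"
proof -
  have len: "length (rev_path p) = length p" for p :: "('a \<times> 'a) list"
    by (induction p) auto
  have "graph_distance G x y \<le> graph_distance G y x" for x y
    unfolding graph_distance_eq
  proof (rule INF_mono)
    fix p assume "p \<in> {p. awalk y p x}"
    then show "\<exists>q\<in>{p. awalk x p y}. ereal (real (length q)) \<le> ereal (real (length p))"
      by (intro bexI[of _ "rev_path p"]) (auto simp: len)
  qed
  from order_antisym[OF this this] show ?thesis .
qed

lemma (in pair_graph) graph_distance_self:
  assumes "u \<in> pverts G" shows "graph_distance G u u = 0"
proof (rule order_antisym)
  have "[] \<in> {p. awalk u p u}" using assms by (simp add: awalk_Nil_iff)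
  from INF_lower[OF this, of "\<lambda>p. ereal (real (length p))"]
  show "graph_distance G u u \<le> 0" by (simp add: graph_distance_eq zero_ereal_def)
  show "0 \<le> graph_distance G u u"
    unfolding graph_distance_eq by (rule INF_greatest) simp
qed

lemma pair_graph_graph_square:
  assumes "pair_graph G"
  shows "pair_graph (graph_square G)"
proof -
  interpret G: pair_graph G by fact
  have fin: "finite (pverts G \<times> pverts G)" by simp
  show ?thesis
  proof unfold_locales
    show "finite (parcs (graph_square G))"
      by (rule finite_subset[OF _ fin]) (auto simp: graph_square_def)
    show "symmetric (with_proj (graph_square G))"
      by (auto simp: symmetric_def graph_square_def sym_def G.graph_distance_commute)
  qed (auto simp: graph_square_def G.graph_distance_self)
qed

lemma ex_proper_colouring:
  assumes "pair_graph G"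
  shows "\<exists>c. proper_colouring G (card (pverts G)) c"
proof -
  interpret G: pair_graph G by fact
  obtain c where c: "bij_betw c (pverts G) {..<card (pverts G)}"
    using ex_bij_betw_finite_nat[OF G.pair_finite_verts] by (auto simp: atLeast0LessThan)
  have "c u \<noteq> c v" if "(u, v) \<in> parcs G" for u v
    using that c G.no_loops'[OF that] G.wellformed'[OF that]
    by (auto simp: bij_betw_def dest: inj_onD)
  then have "proper_colouring G (card (pverts G)) c"
    using c by (auto simp: proper_colouring_def bij_betw_def)
  then show ?thesis by blast
qed

lemma digraph_hom_comp:
  "digraph_hom f D T \<Longrightarrow> digraph_hom g T U \<Longrightarrow> digraph_hom (g \<circ> f) D U"
  by (auto simp: digraph_hom_def)

lemma orientations_target_nat:
  assumes "orientations_target G T"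
  shows "\<exists>U :: nat pair_pre_digraph. orientations_target G U \<and> card (pverts U) = card (pverts T)"
proof -
  interpret T: oriented_graph T using assms by (simp add: orientations_target_def)
  obtain h :: "_ \<Rightarrow> nat" where "bij_betw h (pverts T) {0..<card (pverts T)}"
    using ex_bij_betw_finite_nat[OF T.pair_finite_verts] by auto
  then have inj: "inj_on h (pverts T)" by (rule bij_betw_imp_inj_on)
  define U where "U = \<lparr> pverts = h ` pverts T, parcs = map_prod h h ` parcs T \<rparr>"
  have "oriented_graph U"
  proof unfold_locales
    show "fst e \<in> pverts U" "snd e \<in> pverts U" if "e \<in> parcs U" for e
      using that by (auto simp: U_def dest: T.wellformed')
    show "finite (pverts U)" "finite (parcs U)" by (auto simp: U_def)
    show "fst e \<noteq> snd e" if "e \<in> parcs U" for e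
    proof -
      from that obtain a b where ab: "(a, b) \<in> parcs T" "e = (h a, h b)"
        by (auto simp: U_def)
      then show ?thesis
        using inj T.no_loops'[OF ab(1)] T.wellformed'[OF ab(1)] by (auto dest: inj_onD)
    qed
    show "(v, u) \<notin> parcs U" if uv: "(u, v) \<in> parcs U" for u v
    proof
      assume "(v, u) \<in> parcs U"
      with uv obtain a b c d where
        ab: "(a, b) \<in> parcs T" "u = h a" "v = h b" and cd: "(c, d) \<in> parcs T" "v = h c" "u = h d"
        by (auto simp: U_def)
      have "a = d" "b = c"
        using inj ab cd T.wellformed'[OF ab(1)] T.wellformed'[OF cd(1)] by (auto dest: inj_onD)
      with ab cd T.no_opposite_arcs show False by blast
    qed
  qed
  moreover have "digraph_hom h T U" by (force simp: digraph_hom_def U_def)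
  ultimately have "orientations_target G U"
    using assms unfolding orientations_target_def by (meson digraph_hom_comp)
  moreover have "card (pverts U) = card (pverts T)"
    using inj by (simp add: U_def card_image)
  ultimately show ?thesis by blast
qed

lemma ex_orientations_target:
  assumes "pair_graph G"
  shows "\<exists>T :: nat pair_pre_digraph. orientations_target G T"
proof -
  interpret G: pair_graph G by fact
  define T where "T =
    \<lparr> pverts = pverts G \<times> {A. A \<subseteq> parcs G},
      parcs = {((u, A), (v, B)). A = B \<and> A \<subseteq> parcs G \<and> (u, v) \<in> A \<and> (v, u) \<notin> A} \<rparr>"
  have fin: "finite (pverts T)" by (auto simp: T_def)
  have sub: "parcs T \<subseteq> pverts T \<times> pverts T"
    by (auto simp: T_def dest: G.wellformed')
  have "oriented_graph T"
  proof unfold_locales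
    show "finite (parcs T)" using sub fin by (meson finite_SigmaI finite_subset)
    show "fst e \<in> pverts T" "snd e \<in> pverts T" if "e \<in> parcs T" for e
      using that sub by auto
  qed (use fin in \<open>auto simp: T_def\<close>)
  moreover have "\<exists>f. digraph_hom f D T" if "orientation_of D G" for D
    using that by (intro exI[of _ "\<lambda>u. (u, parcs D)"])
      (auto simp: digraph_hom_def orientation_of_def T_def)
  ultimately have "orientations_target G T" by (simp add: orientations_target_def)
  then show ?thesis using orientations_target_nat by blast
qed

lemma upper_oriented_chromatic_number_attained:
  assumes "pair_graph G"
  obtains T :: "nat pair_pre_digraph"
    where "orientations_target G T" "card (pverts T) = upper_oriented_chromatic_number G"
proof -
  have "\<exists>m. \<exists>T :: nat pair_pre_digraph. orientations_target G T \<and> card (pverts T) = m"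
    using ex_orientations_target[OF assms] by blast
  from LeastI_ex[OF this] show thesis
    using that unfolding upper_oriented_chromatic_number_def by blast
qed

lemma upper_oriented_chromatic_number_le:
  fixes T :: "'b pair_pre_digraph"
  assumes "orientations_target G T"
  shows "upper_oriented_chromatic_number G \<le> card (pverts T)"
  unfolding upper_oriented_chromatic_number_def
  using orientations_target_nat[OF assms] by (intro Least_le)

end

theory Submission
  imports Defs
begin

text \<open>
  In a proper colouring of the square of \<open>G\<close>, every vertex of \<open>G\<close> has at most one neighbour of each
  colour. Given an orientation of \<open>G[H]\<close>, map \<open>(u, v)\<close> to the triple of the colour \<open>i\<close> of \<open>u\<close>, a
  label for each other colour \<open>j\<close>, and the image of \<open>v\<close> under a homomorphism to the target of \<open>H\<close>
  of the orientation induced on the copy of \<open>H\<close> at \<open>u\<close>. The label is \<open>v\<close> itself if \<open>i < j\<close>; if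
  \<open>j < i\<close>, it is the set of in-neighbours of \<open>(u, v)\<close> in the copy of \<open>H\<close> at the only neighbour of
  \<open>u\<close> of colour \<open>j\<close>. For two triples with colours \<open>i < j\<close>, membership of the label of the first in
  the label of the second then determines the direction of the arc. There are
  \<open>n + 2 ^ n\<close> possible labels.
\<close>

lemma (in pair_graph) graph_distance_le_length:
  "awalk u p v \<Longrightarrow> graph_distance G u v \<le> ereal (real (length p))"
  unfolding graph_distance_eq by (rule INF_lower) simp

lemma (in pair_graph) graph_distance_ge:
  assumes "\<And>p. awalk u p v \<Longrightarrow> m \<le> length p"
  shows "ereal (real m) \<le> graph_distance G u v"
  unfolding graph_distance_eq by (rule INF_greatest) (use assms in auto)

lemma (in pair_graph) graph_distance_arc:
  assumes "(u, v) \<in> parcs G" shows "graph_distance G u v = 1"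
proof (rule order_antisym)
  have "awalk u [(u, v)] v"
    using assms wellformed'[OF assms] by (simp add: awalk_Cons_iff awalk_Nil_iff)
  from graph_distance_le_length[OF this] show "graph_distance G u v \<le> 1"
    by (simp add: one_ereal_def)
  have "1 \<le> length p" if "awalk u p v" for p
    using that no_loops'[OF assms] by (cases p) (auto simp: awalk_Nil_iff)
  from graph_distance_ge[OF this] show "1 \<le> graph_distance G u v"
    by (simp add: one_ereal_def)
qed

lemma (in pair_graph) graph_distance_common_neighbour:
  assumes "(u, v) \<in> parcs G" "(v, w) \<in> parcs G" "u \<noteq> w"
  shows "graph_distance G u w = 1 \<or> graph_distance G u w = 2"
proof (cases "(u, w) \<in> parcs G")
  case True
  then show ?thesis using graph_distance_arc by blast
next
  case False
  have "graph_distance G u w = 2"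
  proof (rule order_antisym)
    have "awalk u [(u, v), (v, w)] w"
      using assms wellformed' by (auto simp: awalk_Cons_iff awalk_Nil_iff)
    from graph_distance_le_length[OF this] show "graph_distance G u w \<le> 2"
      by simp
    \<comment> \<open>A walk of length 0 would give \<open>u = w\<close>, one of length 1 an arc
      from \<open>u\<close> to \<open>w\<close>.\<close>
    have "2 \<le> length p" if "awalk u p w" for p
    proof (cases p)
      case Nil
      then show ?thesis using that \<open>u \<noteq> w\<close> by (simp add: awalk_Nil_iff)
    next
      case (Cons e q)
      then show ?thesis
        using that False by (cases q) (auto simp: awalk_Cons_iff awalk_Nil_iff)
    qed
    from graph_distance_ge[OF this] show "2 \<le> graph_distance G u w"
      by simp
  qed
  then show ?thesis ..
qed

lemma square_colouring_arc:
  assumes "pair_graph G" "proper_colouring (graph_square G) k c" "(u, v) \<in> parcs G"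
  shows "c u \<noteq> c v"
proof -
  interpret pair_graph G by fact
  show ?thesis
    using assms(2) graph_distance_arc[OF assms(3)] wellformed'[OF assms(3)]
    by (auto simp: proper_colouring_def graph_square_def)
qed

text \<open>Distinct neighbours of \<open>v\<close> are at distance 1 or 2, hence adjacent in the
  square. So a vertex and a colour determine at most one neighbour.\<close>

lemma square_colouring_neighbour_unique:
  assumes "pair_graph G" "proper_colouring (graph_square G) k c"
    and "(u, v) \<in> parcs G" "(v, w) \<in> parcs G" "c u = c w"
  shows "u = w"
proof (rule ccontr)
  interpret pair_graph G by fact
  assume "u \<noteq> w"
  then show False
    using assms(2,5) graph_distance_common_neighbour[OF assms(3,4)]
      wellformed'[OF assms(3)] wellformed'[OF assms(4)]
    by (auto simp: proper_colouring_def graph_square_def)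
qed

type_synonym ('b, 'c) coloured_label = "nat \<times> (nat \<Rightarrow> 'b + 'b set) \<times> 'c"

text \<open>Meant for \<open>fst x < fst y\<close>. A label of the wrong kind yields
  \<open>False\<close>, so every coordinate can range over the same set of labels.\<close>

definition forward_label :: "('b, 'c) coloured_label \<Rightarrow> ('b, 'c) coloured_label \<Rightarrow> bool" where
  "forward_label x y \<longleftrightarrow>
     (\<exists>v S. fst (snd x) (fst y) = Inl v \<and> fst (snd y) (fst x) = Inr S \<and> v \<in> S)"

text \<open>Between two colours exactly one of the two opposite arcs is present, whatever the
  labels. Within a colour the labels are ignored and \<open>T\<close> decides. Extensional functions
  make the vertices countable by coordinates.\<close>

definition lex_target ::
    "nat \<Rightarrow> 'b set \<Rightarrow> 'c pair_pre_digraph \<Rightarrow> ('b, 'c) coloured_label pair_pre_digraph" where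
  "lex_target k B T =
     (let V = (SIGMA i:{..<k}. (({..<k} - {i}) \<rightarrow>\<^sub>E (B <+> Pow B)) \<times> pverts T)
      in \<lparr> pverts = V,
           parcs = {(x, y). x \<in> V \<and> y \<in> V \<and>
             (fst x = fst y \<and> (snd (snd x), snd (snd y)) \<in> parcs T \<or>
              fst x < fst y \<and> forward_label x y \<or>
              fst y < fst x \<and> \<not> forward_label y x)} \<rparr>)"

lemma card_lex_target:
  assumes "finite B" "finite (pverts T)"
  shows "card (pverts (lex_target k B T)) =
    k * (card B + 2 ^ card B) ^ (k - 1) * card (pverts T)"
proof -
  \<comment> \<open>For \<open>k = 0\<close> there is no such \<open>i\<close> and both sides of the
    goal are 0, so the truncated \<open>k - 1\<close> is harmless.\<close>
  have "card (({..<k} - {i}) \<rightarrow>\<^sub>E (B <+> Pow B)) = (card B + 2 ^ card B) ^ (k - 1)"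
    if "i < k" for i
    using that assms by (simp add: card_PiE card_Plus card_Pow)
  then show ?thesis
    using assms
    by (simp add: lex_target_def Let_def card_SigmaI finite_PiE card_cartesian_product)
qed

lemma oriented_graph_lex_target:
  assumes "oriented_graph T" "finite B"
  shows "oriented_graph (lex_target k B T)"
proof -
  interpret T: oriented_graph T by fact
  let ?U = "lex_target k B T"
  have fin: "finite (pverts ?U)"
    using assms(2) unfolding lex_target_def Let_def
    by (simp, intro finite_SigmaI finite_PiE) simp_all
  have sub: "parcs ?U \<subseteq> pverts ?U \<times> pverts ?U"
    by (auto simp: lex_target_def Let_def)
  have arcD: "fst x = fst y \<and> (snd (snd x), snd (snd y)) \<in> parcs T \<or>
      fst x < fst y \<and> forward_label x y \<or> fst y < fst x \<and> \<not> forward_label y x"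
    if "(x, y) \<in> parcs ?U" for x y
    using that by (simp add: lex_target_def Let_def)
  show ?thesis
  proof unfold_locales
    show "finite (parcs ?U)"
      using sub fin by (meson finite_SigmaI finite_subset)
    show "fst e \<in> pverts ?U" "snd e \<in> pverts ?U" if "e \<in> parcs ?U" for e
      using that sub by auto
    show "finite (pverts ?U)" by (fact fin)
    show asym: "(y, x) \<notin> parcs ?U" if "(x, y) \<in> parcs ?U" for x y
      using arcD[of x y] arcD[of y x] that T.no_opposite_arcs by (metis less_asym less_irrefl)
    \<comment> \<open>A loop would be its own opposite arc.\<close>
    show "fst e \<noteq> snd e" if "e \<in> parcs ?U" for e
      using that asym by (metis prod.collapse)
  qed
qed

text \<open>Since \<open>G\<close> has no loops, arcs of the product over a single \<open>u\<close>
  come from \<open>H\<close> alone.\<close>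

lemma orientation_of_fibre:
  assumes "pair_graph G" "pair_graph H" "orientation_of D (lex_product G H)" "u \<in> pverts G"
  shows "orientation_of \<lparr> pverts = pverts H, parcs = {(v, w). ((u, v), (u, w)) \<in> parcs D} \<rparr> H"
proof -
  interpret G: pair_graph G by fact
  interpret H: pair_graph H by fact
  have arc: "((u, v), (u, w)) \<in> parcs (lex_product G H) \<longleftrightarrow> (v, w) \<in> parcs H" for v w
    using assms(4) H.wellformed' by (auto simp: lex_product_def dest: G.no_loops')
  show ?thesis
    using assms(3) arc by (auto simp: orientation_of_def)
qed

lemma orientations_target_lex_target:
  assumes G: "pair_graph G" and H: "pair_graph H"
    and c: "proper_colouring (graph_square G) k c" and T: "orientations_target H T"
  shows "orientations_target (lex_product G H) (lex_target k (pverts H) T)"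
  unfolding orientations_target_def
proof (intro conjI allI impI)
  interpret H: pair_graph H by fact
  show "oriented_graph (lex_target k (pverts H) T)"
    using T by (intro oriented_graph_lex_target) (auto simp: orientations_target_def)
  fix D assume D: "orientation_of D (lex_product G H)"
  \<comment> \<open>The copies of \<open>H\<close> may be oriented differently, so each
    \<open>u\<close> gets its own homomorphism, all into the same \<open>T\<close>.\<close>
  have "\<exists>f. digraph_hom f
      \<lparr> pverts = pverts H, parcs = {(v, w). ((u, v), (u, w)) \<in> parcs D} \<rparr> T"
    if "u \<in> pverts G" for u
    using T orientation_of_fibre[OF G H D that] by (auto simp: orientations_target_def)
  then obtain f where f: "\<And>u. u \<in> pverts G \<Longrightarrow> digraph_hom (f u)
      \<lparr> pverts = pverts H, parcs = {(v, w). ((u, v), (u, w)) \<in> parcs D} \<rparr> T"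
    by metis
  \<comment> \<open>Ranging over all \<open>z\<close> of colour \<open>j\<close> avoids choosing the
    neighbour of \<open>u\<close>; the set is empty if there is none.\<close>
  define lab where "lab u v = (\<lambda>j\<in>{..<k} - {c u}.
      if c u < j then Inl v
      else Inr {w \<in> pverts H. \<exists>z. c z = j \<and> ((z, w), (u, v)) \<in> parcs D})" for u v
  define h where "h = (\<lambda>(u, v). (c u, lab u v, f u v))"
  have ck: "c u < k" if "u \<in> pverts G" for u
    using c that by (auto simp: proper_colouring_def graph_square_def)
  have h_vert: "h (u, v) \<in> pverts (lex_target k (pverts H) T)"
    if "u \<in> pverts G" "v \<in> pverts H" for u v
  proof -
    have "lab u v \<in> ({..<k} - {c u}) \<rightarrow>\<^sub>E (pverts H <+> Pow (pverts H))"
      using that unfolding lab_def by (intro restrict_PiE_iff[THEN iffD2]) (auto split: if_split)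
    moreover have "f u v \<in> pverts T"
      using that f[of u] by (auto simp: digraph_hom_def)
    ultimately show ?thesis
      using that ck by (simp add: h_def lex_target_def Let_def)
  qed
  have arcD: "u \<in> pverts G \<and> u' \<in> pverts G \<and> v \<in> pverts H \<and> v' \<in> pverts H \<and>
      ((u', v'), (u, v)) \<notin> parcs D \<and> (u = u' \<or> (u, u') \<in> parcs G)"
    if "((u, v), (u', v')) \<in> parcs D" for u v u' v'
  proof -
    have "((u, v), (u', v')) \<in> parcs (lex_product G H)"
      using D that by (auto simp: orientation_of_def)
    moreover from this have "((u', v'), (u, v)) \<notin> parcs D"
      using D that unfolding orientation_of_def by blast
    ultimately show ?thesis by (auto simp: lex_product_def)
  qed
  have h_arc: "(h (u, v), h (u', v')) \<in> parcs (lex_target k (pverts H) T)"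
    if a: "((u, v), (u', v')) \<in> parcs D" for u v u' v'
  proof -
    note verts = arcD[OF a]
    have hv: "h (u, v) \<in> pverts (lex_target k (pverts H) T)"
      "h (u', v') \<in> pverts (lex_target k (pverts H) T)"
      using h_vert verts by auto
    consider "u = u'" | "(u, u') \<in> parcs G" "c u < c u'" | "(u, u') \<in> parcs G" "c u' < c u"
      using verts square_colouring_arc[OF G c] by (metis linorder_neqE_nat)
    then have "fst (h (u, v)) = fst (h (u', v')) \<and>
          (snd (snd (h (u, v))), snd (snd (h (u', v')))) \<in> parcs T \<or>
        fst (h (u, v)) < fst (h (u', v')) \<and> forward_label (h (u, v)) (h (u', v')) \<or>
        fst (h (u', v')) < fst (h (u, v)) \<and> \<not> forward_label (h (u', v')) (h (u, v))"
    proof cases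
      case 1
      then show ?thesis using f[of u] verts a by (auto simp: h_def digraph_hom_def)
    next
      case 2
      then show ?thesis
        using verts a ck by (auto simp: h_def lab_def forward_label_def)
    next
      case 3
      \<comment> \<open>The arc descends in colour, so \<open>v'\<close> must be absent from the set
        that \<open>(u, v)\<close> carries at colour \<open>c u'\<close>. A witness \<open>z\<close>
        would have to be \<open>u'\<close>, giving \<open>D\<close> two opposite arcs.\<close>
      have "\<not> (c z = c u' \<and> ((z, v'), (u, v)) \<in> parcs D)" for z
      proof
        assume z: "c z = c u' \<and> ((z, v'), (u, v)) \<in> parcs D"
        then have "(z, u) \<in> parcs G" using arcD 3 by fastforce
        then have "z = u'"
          using square_colouring_neighbour_unique[OF G c] 3 z by blast
        then show False using z verts by blast
      qed
      then show ?thesis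
        using 3 verts ck by (auto simp: h_def lab_def forward_label_def)
    qed
    then show ?thesis using hv by (simp add: lex_target_def Let_def)
  qed
  have "pverts D = pverts G \<times> pverts H"
    using D by (simp add: orientation_of_def lex_product_def)
  then have "digraph_hom h D (lex_target k (pverts H) T)"
    using h_vert h_arc by (auto simp: digraph_hom_def)
  then show "\<exists>h. digraph_hom h D (lex_target k (pverts H) T)" by blast
qed

theorem theorem6:
  fixes G :: "'a pair_pre_digraph" and H :: "'b pair_pre_digraph" and k n :: nat
  assumes "pair_graph G" and "pair_graph H"
    and "k = chromatic_number (graph_square G)"
    and "n = card (pverts H)"
  shows "upper_oriented_chromatic_number (lex_product G H)
         \<le> k * (n + 2 ^ n) ^ (k - 1) * upper_oriented_chromatic_number H"
proof -
  interpret H: pair_graph H by fact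
  \<comment> \<open>The \<open>LEAST\<close> in \<open>chromatic_number\<close> is attained once
    some colouring exists; one colour per vertex serves.\<close>
  have "\<exists>k c. proper_colouring (graph_square G) k c"
    using ex_proper_colouring[OF pair_graph_graph_square[OF assms(1)]] by blast
  then have "\<exists>c. proper_colouring (graph_square G) k c"
    unfolding assms(3) chromatic_number_def by (rule LeastI_ex)
  then obtain c where c: "proper_colouring (graph_square G) k c" ..
  obtain T :: "nat pair_pre_digraph" where T: "orientations_target H T"
    "card (pverts T) = upper_oriented_chromatic_number H"
    using upper_oriented_chromatic_number_attained[OF assms(2)] .
  interpret T: oriented_graph T using T(1) by (simp add: orientations_target_def)
  have "card (pverts (lex_target k (pverts H) T)) =
      k * (n + 2 ^ n) ^ (k - 1) * upper_oriented_chromatic_number H"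
    using T(2) assms(4) by (simp add: card_lex_target)
  then show ?thesis
    using upper_oriented_chromatic_number_le[OF
        orientations_target_lex_target[OF assms(1,2) c T(1)]] by simp
qed

end
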